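(* Let $\widehat{\Sigma}$ be a lifted signature over $\mathbf{GMet}$, let $S$ be a set of Horn clauses over $\Sigma$ and variables $X$, and let $\vdash_S$ be the quantitative theory axiomatised by $S$. If $\mathbb{A}=(A,d,[\![\cdot]\!])\in \mathbf{Alg}(\widehat{\Sigma},S)$ and $H\in{\vdash_S}$, then $\mathbb{A}\models H$.
   Context: Generalised metric spaces. A fuzzy relation is a pair $(A,d)$ with $A$ a set and $d:A\times A\to[0,1]$; a map $f:(A,d)\to(B,\Delta)$ is nonexpansive if $\Delta(f(a),f(a'))\le d(a,a')$ for all $a,a'$. Fix a subset $G$ of the following axioms: (S) $d(a,b)=d(b,a)$; (R) $d(a,a)=0$; (I) $d(a,b)=0\Rightarrow a=b$; (T) $d(a,c)\le d(a,b)+d(b,c)$; (U) $d(a,c)\le\max\{d(a,b),d(b,c)\}$ (all universally quantified). $\mathbf{GMet}$ is the category whose objects are the fuzzy relations satisfying the axioms in $G$ and whose morphisms are the nonexpansive maps. An isometric embedding is an injective map $f$ with $\Delta(f(a),f(a'))=d(a,a')$. Lifted signatures. A lifting of the $n$-fold product functor $(-)^n:\mathbf{Set}\to\mathbf{Set}$ is a functor $L:\mathbf{GMet}\to\mathbf{GMet}$ with $U\circ L=(-)^n\circ U$ ($U$ the forgetful functor); thus $L(A,d)=(A^n,L(d))$ for some fuzzy relation $L(d)$ on $A^n$, and $L(f)=f^n$. $L$ preserves isometric embeddings if $L(f)$ is an isometric embedding whenever $f$ is. A lifted signature $\widehat{\Sigma}=\{\mathsf{op}_i:n_i:L_{\mathsf{op}_i}\}_{i\in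 I}$ consists of a signature $\Sigma$ (operation symbols $\mathsf{op}_i$ with arities $n_i$) together with, for each $\mathsf{op}_i$, a lifting $L_{\mathsf{op}_i}$ of $(-)^{n_i}$ that preserves isometric embeddings. A quantitative $\widehat{\Sigma}$-algebra is $(A,d)\in\mathbf{GMet}$ with, for each $\mathsf{op}:n:L_{\mathsf{op}}$, a map $[\![\mathsf{op}]\!]:A^n\to A$ that is nonexpansive as a map $(A^n,L_{\mathsf{op}}(d))\to(A,d)$. Equations and clauses. $X$ is a fixed countable set of variables and $T_\Sigma X$ the set of $\Sigma$-terms over $X$. An equation is $s=t$ and a quantitative equation is $s=_\varepsilon t$ ($s,t\in T_\Sigma X$, $\varepsilon\in[0,1]$). For an assignment $\iota:X\to A$ with homomorphic extension $[\![\cdot]\!]^\iota$, $s=t$ holds at $\iota$ iff $[\![s]\!]^\iota=[\![t]\!]^\iota$, and $s=_\varepsilon t$ holds at $\iota$ iff $d([\![s]\!]^\iota,[\![t]\!]^\iota)\le\varepsilon$. A Horn clause is a pair of a (possibly infinite) set $\Gamma$ of (quantitative) equations and a (quantitative) equation $\phi$, written $\Gamma\vdash\phi$; an algebra satisfies it if for every assignment, whenever all elements of $\Gamma$ hold then $\phi$ holds. $\mathbf{Alg}(\widehat{\Sigma},S)$ is the class of quantitative $\widehat{\Sigma}$-algebras satisfying every clause of $S$. Quantitative theories. A quantitative theory over $\widehat{\Sigma}$ is a set $\vdash$ of Horn clauses such that: (I) it is closed under Sub (if $\Gamma\vdash\phi$ then $\sigma^*(\Gamma)\vdash\sigma^*(\phi)$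 for every substitution $\sigma:X\to T_\Sigma X$), Cut (if $\Gamma\vdash\phi$ for every $\phi\in\Gamma'$ and $\Gamma'\vdash\psi$ then $\Gamma\vdash\psi$) and Hyp ($\phi\in\Gamma$ implies $\Gamma\vdash\phi$); (II) it contains $\emptyset\vdash x=x$, $x=y\vdash y=x$, $\{x=y,y=z\}\vdash x=z$, and $\{x_i=y_i\}_{1\le i\le n}\vdash\mathsf{op}(x_1,\dots,x_n)=\mathsf{op}(y_1,\dots,y_n)$ for each $\mathsf{op}$; (III) it contains $\emptyset\vdash x=_1y$, $x=_\varepsilon y\vdash x=_{\varepsilon'}y$ for $\varepsilon'\ge\varepsilon$, and $\{x=_{\varepsilon_i}y\}_{i\in I}\vdash x=_{\inf_i\varepsilon_i}y$; (IV) it contains $\{x=y,x=_\varepsilon z\}\vdash y=_\varepsilon z$ and $\{x=y,z=_\varepsilon x\}\vdash z=_\varepsilon y$; (V) for each axiom in $G$ it contains the corresponding clauses: for (S) $x=_\varepsilon y\vdash y=_\varepsilon x$; for (R) $\emptyset\vdash x=_0x$; for (I) $x=_0y\vdash x=y$; for (T) $\{x=_\varepsilon y,y=_{\varepsilon'}z\}\vdash x=_{\varepsilon+\varepsilon'}z$; for (U) $\{x=_\varepsilon y,y=_{\varepsilon'}z\}\vdash x=_{\max\{\varepsilon,\varepsilon'\}}z$; (VI) ($L$-NE) for each $\mathsf{op}:n:L_{\mathsf{op}}$, all variables $x_1,\dots,x_n,y_1,\dots,y_n$ (not necessarily distinct) and every fuzzy relation $\Delta$ on $V=\{x_1,\dots,x_n,y_1,\dots,y_n\}$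 with $(V,\Delta)\in\mathbf{GMet}$, it contains $\{w=_{\Delta(w,z)}z\mid w,z\in V\}\vdash\mathsf{op}(\vec x)=_\delta\mathsf{op}(\vec y)$ where $\delta=L_{\mathsf{op}}(\Delta)(\vec x,\vec y)$. $\vdash_S$ denotes the smallest quantitative theory containing $S$. *)

theory Defs
  imports Complex_Main "HOL-Library.Countable_Set"
begin

text \<open>
  A type variable \<open>'u\<close> serves as the universe of small sets: the sets of variables and the
  carriers of algebras are arbitrary subsets of it. A fuzzy relation \<open>(A, d)\<close> is given by a
  carrier \<open>A\<close> and a function \<open>d\<close> of which only the values on \<open>A \<times> A\<close> matter.
\<close>

datatype gaxiom = Ax_S | Ax_R | Ax_I | Ax_T | Ax_U

definition fuzzy_relation :: "'a set \<Rightarrow> ('a \<Rightarrow> 'a \<Rightarrow> real) \<Rightarrow> bool" where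
  "fuzzy_relation A d \<longleftrightarrow> (\<forall>a\<in>A. \<forall>b\<in>A. d a b \<in> {0..1})"

primrec satisfies_gaxiom :: "'a set \<Rightarrow> ('a \<Rightarrow> 'a \<Rightarrow> real) \<Rightarrow> gaxiom \<Rightarrow> bool" where
  "satisfies_gaxiom A d Ax_S \<longleftrightarrow> (\<forall>a\<in>A. \<forall>b\<in>A. d a b = d b a)"
| "satisfies_gaxiom A d Ax_R \<longleftrightarrow> (\<forall>a\<in>A. d a a = 0)"
| "satisfies_gaxiom A d Ax_I \<longleftrightarrow> (\<forall>a\<in>A. \<forall>b\<in>A. d a b = 0 \<longrightarrow> a = b)"
| "satisfies_gaxiom A d Ax_T \<longleftrightarrow> (\<forall>a\<in>A. \<forall>b\<in>A. \<forall>c\<in>A. d a c \<le> d a b + d b c)"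
| "satisfies_gaxiom A d Ax_U \<longleftrightarrow> (\<forall>a\<in>A. \<forall>b\<in>A. \<forall>c\<in>A. d a c \<le> max (d a b) (d b c))"

definition gmet :: "gaxiom set \<Rightarrow> 'a set \<Rightarrow> ('a \<Rightarrow> 'a \<Rightarrow> real) \<Rightarrow> bool" where
  "gmet G A d \<longleftrightarrow> fuzzy_relation A d \<and> (\<forall>ax\<in>G. satisfies_gaxiom A d ax)"

definition nonexpansive ::
  "'a set \<Rightarrow> ('a \<Rightarrow> 'a \<Rightarrow> real) \<Rightarrow> 'b set \<Rightarrow> ('b \<Rightarrow> 'b \<Rightarrow> real) \<Rightarrow> ('a \<Rightarrow> 'b) \<Rightarrow> bool" where
  "nonexpansive A d B \<Delta> f \<longleftrightarrow>
     (\<forall>a\<in>A. f a \<in> B) \<and> (\<forall>a\<in>A. \<forall>a'\<in>A. \<Delta> (f a) (f a') \<le> d a a')"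

definition isometric_embedding ::
  "'a set \<Rightarrow> ('a \<Rightarrow> 'a \<Rightarrow> real) \<Rightarrow> 'b set \<Rightarrow> ('b \<Rightarrow> 'b \<Rightarrow> real) \<Rightarrow> ('a \<Rightarrow> 'b) \<Rightarrow> bool" where
  "isometric_embedding A d B \<Delta> f \<longleftrightarrow>
     (\<forall>a\<in>A. f a \<in> B) \<and> inj_on f A \<and> (\<forall>a\<in>A. \<forall>a'\<in>A. \<Delta> (f a) (f a') = d a a')"

definition tuples :: "nat \<Rightarrow> 'a set \<Rightarrow> 'a list set" where
  "tuples n A = {xs. length xs = n \<and> set xs \<subseteq> A}"

type_synonym 'u lift_op = "'u set \<Rightarrow> ('u \<Rightarrow> 'u \<Rightarrow> real) \<Rightarrow> 'u list \<Rightarrow> 'u list \<Rightarrow> real"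

text \<open>
  A functor \<open>L\<close> with \<open>U \<circ> L = (-)\<^sup>n \<circ> U\<close> is determined by the fuzzy relations \<open>L A d\<close> on \<open>A\<^sup>n\<close>:
  its action on a morphism \<open>f\<close> is forced to be \<open>map f\<close>, so the functor laws are automatic and
  only well-definedness on objects and on morphisms remains. The second conjunct, applied to
  the identity, also shows that \<open>L A d\<close> depends on \<open>d\<close> only through its values on \<open>A \<times> A\<close>.
\<close>

definition lifting :: "gaxiom set \<Rightarrow> nat \<Rightarrow> 'u lift_op \<Rightarrow> bool" where
  "lifting G n L \<longleftrightarrow>
     (\<forall>A d. gmet G A d \<longrightarrow> gmet G (tuples n A) (L A d)) \<and>
     (\<forall>A d B \<Delta> f. gmet G A d \<longrightarrow> gmet G B \<Delta> \<longrightarrow> nonexpansive A d B \<Delta> f \<longrightarrow>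
        nonexpansive (tuples n A) (L A d) (tuples n B) (L B \<Delta>) (map f))"

definition preserves_isometric_embeddings :: "gaxiom set \<Rightarrow> nat \<Rightarrow> 'u lift_op \<Rightarrow> bool" where
  "preserves_isometric_embeddings G n L \<longleftrightarrow>
     (\<forall>A d B \<Delta> f. gmet G A d \<longrightarrow> gmet G B \<Delta> \<longrightarrow> isometric_embedding A d B \<Delta> f \<longrightarrow>
        isometric_embedding (tuples n A) (L A d) (tuples n B) (L B \<Delta>) (map f))"

record ('f, 'u) signature =
  symbols :: "'f set"
  arity :: "'f \<Rightarrow> nat"
  lift_of :: "'f \<Rightarrow> 'u lift_op"

definition lifted_signature :: "gaxiom set \<Rightarrow> ('f, 'u) signature \<Rightarrow> bool" where
  "lifted_signature G \<Sigma> \<longleftrightarrow>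
     (\<forall>f\<in>symbols \<Sigma>. lifting G (arity \<Sigma> f) (lift_of \<Sigma> f) \<and>
        preserves_isometric_embeddings G (arity \<Sigma> f) (lift_of \<Sigma> f))"

type_synonym ('f, 'u) algebra = "'u set \<times> ('u \<Rightarrow> 'u \<Rightarrow> real) \<times> ('f \<Rightarrow> 'u list \<Rightarrow> 'u)"

definition quantitative_algebra ::
  "gaxiom set \<Rightarrow> ('f, 'u) signature \<Rightarrow> ('f, 'u) algebra \<Rightarrow> bool" where
  "quantitative_algebra G \<Sigma> = (\<lambda>(A, d, ops). gmet G A d \<and>
     (\<forall>f\<in>symbols \<Sigma>. nonexpansive (tuples (arity \<Sigma> f) A) (lift_of \<Sigma> f A d) A d (ops f)))"

datatype ('f, 'v) trm = Var 'v | Op 'f "('f, 'v) trm list"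

inductive_set terms :: "('f, 'u) signature \<Rightarrow> 'u set \<Rightarrow> ('f, 'u) trm set"
  for \<Sigma> :: "('f, 'u) signature" and X :: "'u set" where
  Var: "x \<in> X \<Longrightarrow> Var x \<in> terms \<Sigma> X"
| Op: "f \<in> symbols \<Sigma> \<Longrightarrow> length ts = arity \<Sigma> f \<Longrightarrow> (\<And>t. t \<in> set ts \<Longrightarrow> t \<in> terms \<Sigma> X) \<Longrightarrow>
     Op f ts \<in> terms \<Sigma> X"

primrec eval :: "('f \<Rightarrow> 'a list \<Rightarrow> 'a) \<Rightarrow> ('v \<Rightarrow> 'a) \<Rightarrow> ('f, 'v) trm \<Rightarrow> 'a" where
  "eval ops \<iota> (Var x) = \<iota> x"
| "eval ops \<iota> (Op f ts) = ops f (map (eval ops \<iota>) ts)"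

primrec subst_trm :: "('v \<Rightarrow> ('f, 'w) trm) \<Rightarrow> ('f, 'v) trm \<Rightarrow> ('f, 'w) trm" where
  "subst_trm \<sigma> (Var x) = \<sigma> x"
| "subst_trm \<sigma> (Op f ts) = Op f (map (subst_trm \<sigma>) ts)"

text \<open>\<open>Eq s t\<close> is the equation \<open>s = t\<close>, and \<open>QEq \<epsilon> s t\<close> the quantitative equation \<open>s =\<^sub>\<epsilon> t\<close>.\<close>

datatype ('f, 'v) eqn =
    Eq "('f, 'v) trm" "('f, 'v) trm"
  | QEq real "('f, 'v) trm" "('f, 'v) trm"

primrec subst_eqn :: "('v \<Rightarrow> ('f, 'w) trm) \<Rightarrow> ('f, 'v) eqn \<Rightarrow> ('f, 'w) eqn" where
  "subst_eqn \<sigma> (Eq s t) = Eq (subst_trm \<sigma> s) (subst_trm \<sigma> t)"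
| "subst_eqn \<sigma> (QEq \<epsilon> s t) = QEq \<epsilon> (subst_trm \<sigma> s) (subst_trm \<sigma> t)"

definition equations :: "('f, 'u) signature \<Rightarrow> 'u set \<Rightarrow> ('f, 'u) eqn set" where
  "equations \<Sigma> X =
     {Eq s t | s t. s \<in> terms \<Sigma> X \<and> t \<in> terms \<Sigma> X} \<union>
     {QEq \<epsilon> s t | \<epsilon> s t. \<epsilon> \<in> {0..1} \<and> s \<in> terms \<Sigma> X \<and> t \<in> terms \<Sigma> X}"

type_synonym ('f, 'v) clause = "('f, 'v) eqn set \<times> ('f, 'v) eqn"

definition horn_clauses :: "('f, 'u) signature \<Rightarrow> 'u set \<Rightarrow> ('f, 'u) clause set" where
  "horn_clauses \<Sigma> X = {(\<Gamma>, \<phi>). \<Gamma> \<subseteq> equations \<Sigma> X \<and> \<phi> \<in> equations \<Sigma> X}"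

primrec holds ::
  "('a \<Rightarrow> 'a \<Rightarrow> real) \<Rightarrow> ('f \<Rightarrow> 'a list \<Rightarrow> 'a) \<Rightarrow> ('v \<Rightarrow> 'a) \<Rightarrow> ('f, 'v) eqn \<Rightarrow> bool" where
  "holds d ops \<iota> (Eq s t) \<longleftrightarrow> eval ops \<iota> s = eval ops \<iota> t"
| "holds d ops \<iota> (QEq \<epsilon> s t) \<longleftrightarrow> d (eval ops \<iota> s) (eval ops \<iota> t) \<le> \<epsilon>"

definition satisfies :: "'u set \<Rightarrow> ('f, 'u) algebra \<Rightarrow> ('f, 'u) clause \<Rightarrow> bool" where
  "satisfies X = (\<lambda>(A, d, ops) (\<Gamma>, \<phi>).
     \<forall>\<iota>. (\<forall>x\<in>X. \<iota> x \<in> A) \<longrightarrow> (\<forall>\<psi>\<in>\<Gamma>. holds d ops \<iota> \<psi>) \<longrightarrow> holds d ops \<iota> \<phi>)"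

definition Alg ::
  "gaxiom set \<Rightarrow> ('f, 'u) signature \<Rightarrow> 'u set \<Rightarrow> ('f, 'u) clause set \<Rightarrow> ('f, 'u) algebra set" where
  "Alg G \<Sigma> X S = {\<A>. quantitative_algebra G \<Sigma> \<A> \<and> (\<forall>H\<in>S. satisfies X \<A> H)}"

text \<open>
  Two conventions keep the indices of quantitative equations in \<open>[0,1]\<close>. In \<open>infimum\<close> the family
  of indices is represented by its set of values \<open>E\<close>, and the infimum is the one of the
  complete lattice \<open>[0,1]\<close>, so that it is \<open>1\<close> for the empty family. In \<open>triangle\<close> the sum is
  truncated at \<open>1\<close>; in view of \<open>one\<close> this generates the same theories as restricting the
  clause to \<open>\<epsilon> + \<epsilon>' \<le> 1\<close>.
\<close>

inductive_set base_clauses ::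
  "gaxiom set \<Rightarrow> ('f, 'u) signature \<Rightarrow> 'u set \<Rightarrow> ('f, 'u) clause set"
  for G :: "gaxiom set" and \<Sigma> :: "('f, 'u) signature" and X :: "'u set" where
  eq_refl: "x \<in> X \<Longrightarrow> ({}, Eq (Var x) (Var x)) \<in> base_clauses G \<Sigma> X"
| eq_sym: "x \<in> X \<Longrightarrow> y \<in> X \<Longrightarrow>
    ({Eq (Var x) (Var y)}, Eq (Var y) (Var x)) \<in> base_clauses G \<Sigma> X"
| eq_trans: "x \<in> X \<Longrightarrow> y \<in> X \<Longrightarrow> z \<in> X \<Longrightarrow>
    ({Eq (Var x) (Var y), Eq (Var y) (Var z)}, Eq (Var x) (Var z)) \<in> base_clauses G \<Sigma> X"
| eq_cong: "f \<in> symbols \<Sigma> \<Longrightarrow> xs \<in> tuples (arity \<Sigma> f) X \<Longrightarrow> ys \<in> tuples (arity \<Sigma> f) X \<Longrightarrow>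
    ({Eq (Var (xs ! i)) (Var (ys ! i)) | i. i < arity \<Sigma> f},
     Eq (Op f (map Var xs)) (Op f (map Var ys))) \<in> base_clauses G \<Sigma> X"
| one: "x \<in> X \<Longrightarrow> y \<in> X \<Longrightarrow> ({}, QEq 1 (Var x) (Var y)) \<in> base_clauses G \<Sigma> X"
| up: "x \<in> X \<Longrightarrow> y \<in> X \<Longrightarrow> \<epsilon> \<in> {0..1} \<Longrightarrow> \<epsilon>' \<in> {0..1} \<Longrightarrow> \<epsilon> \<le> \<epsilon>' \<Longrightarrow>
    ({QEq \<epsilon> (Var x) (Var y)}, QEq \<epsilon>' (Var x) (Var y)) \<in> base_clauses G \<Sigma> X"
| infimum: "x \<in> X \<Longrightarrow> y \<in> X \<Longrightarrow> E \<subseteq> {0..1} \<Longrightarrow>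
    ({QEq \<epsilon> (Var x) (Var y) | \<epsilon>. \<epsilon> \<in> E}, QEq (Inf (insert 1 E)) (Var x) (Var y))
      \<in> base_clauses G \<Sigma> X"
| compat_left: "x \<in> X \<Longrightarrow> y \<in> X \<Longrightarrow> z \<in> X \<Longrightarrow> \<epsilon> \<in> {0..1} \<Longrightarrow>
    ({Eq (Var x) (Var y), QEq \<epsilon> (Var x) (Var z)}, QEq \<epsilon> (Var y) (Var z)) \<in> base_clauses G \<Sigma> X"
| compat_right: "x \<in> X \<Longrightarrow> y \<in> X \<Longrightarrow> z \<in> X \<Longrightarrow> \<epsilon> \<in> {0..1} \<Longrightarrow>
    ({Eq (Var x) (Var y), QEq \<epsilon> (Var z) (Var x)}, QEq \<epsilon> (Var z) (Var y)) \<in> base_clauses G \<Sigma> X"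
| symmetry: "Ax_S \<in> G \<Longrightarrow> x \<in> X \<Longrightarrow> y \<in> X \<Longrightarrow> \<epsilon> \<in> {0..1} \<Longrightarrow>
    ({QEq \<epsilon> (Var x) (Var y)}, QEq \<epsilon> (Var y) (Var x)) \<in> base_clauses G \<Sigma> X"
| reflexivity: "Ax_R \<in> G \<Longrightarrow> x \<in> X \<Longrightarrow> ({}, QEq 0 (Var x) (Var x)) \<in> base_clauses G \<Sigma> X"
| indiscernibles: "Ax_I \<in> G \<Longrightarrow> x \<in> X \<Longrightarrow> y \<in> X \<Longrightarrow>
    ({QEq 0 (Var x) (Var y)}, Eq (Var x) (Var y)) \<in> base_clauses G \<Sigma> X"
| triangle: "Ax_T \<in> G \<Longrightarrow> x \<in> X \<Longrightarrow> y \<in> X \<Longrightarrow> z \<in> X \<Longrightarrow> \<epsilon> \<in> {0..1} \<Longrightarrow> \<epsilon>' \<in> {0..1} \<Longrightarrow>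
    ({QEq \<epsilon> (Var x) (Var y), QEq \<epsilon>' (Var y) (Var z)}, QEq (min 1 (\<epsilon> + \<epsilon>')) (Var x) (Var z))
      \<in> base_clauses G \<Sigma> X"
| ultra_triangle: "Ax_U \<in> G \<Longrightarrow> x \<in> X \<Longrightarrow> y \<in> X \<Longrightarrow> z \<in> X \<Longrightarrow> \<epsilon> \<in> {0..1} \<Longrightarrow> \<epsilon>' \<in> {0..1} \<Longrightarrow>
    ({QEq \<epsilon> (Var x) (Var y), QEq \<epsilon>' (Var y) (Var z)}, QEq (max \<epsilon> \<epsilon>') (Var x) (Var z))
      \<in> base_clauses G \<Sigma> X"
| L_NE: "f \<in> symbols \<Sigma> \<Longrightarrow> xs \<in> tuples (arity \<Sigma> f) X \<Longrightarrow> ys \<in> tuples (arity \<Sigma> f) X \<Longrightarrow>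
    V = set xs \<union> set ys \<Longrightarrow> gmet G V \<Delta> \<Longrightarrow>
    ({QEq (\<Delta> w z) (Var w) (Var z) | w z. w \<in> V \<and> z \<in> V},
     QEq (lift_of \<Sigma> f V \<Delta> xs ys) (Op f (map Var xs)) (Op f (map Var ys)))
      \<in> base_clauses G \<Sigma> X"

definition quantitative_theory ::
  "gaxiom set \<Rightarrow> ('f, 'u) signature \<Rightarrow> 'u set \<Rightarrow> ('f, 'u) clause set \<Rightarrow> bool" where
  "quantitative_theory G \<Sigma> X T \<longleftrightarrow>
     T \<subseteq> horn_clauses \<Sigma> X \<and>
     (\<forall>\<sigma> \<Gamma> \<phi>. (\<forall>x\<in>X. \<sigma> x \<in> terms \<Sigma> X) \<longrightarrow> (\<Gamma>, \<phi>) \<in> T \<longrightarrow>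
        (subst_eqn \<sigma> ` \<Gamma>, subst_eqn \<sigma> \<phi>) \<in> T) \<and>
     (\<forall>\<Gamma> \<Gamma>' \<psi>. \<Gamma> \<subseteq> equations \<Sigma> X \<longrightarrow> (\<forall>\<phi>\<in>\<Gamma>'. (\<Gamma>, \<phi>) \<in> T) \<longrightarrow> (\<Gamma>', \<psi>) \<in> T \<longrightarrow>
        (\<Gamma>, \<psi>) \<in> T) \<and>
     (\<forall>\<Gamma> \<phi>. \<Gamma> \<subseteq> equations \<Sigma> X \<longrightarrow> \<phi> \<in> \<Gamma> \<longrightarrow> (\<Gamma>, \<phi>) \<in> T) \<and>
     base_clauses G \<Sigma> X \<subseteq> T"

definition theory_of ::
  "gaxiom set \<Rightarrow> ('f, 'u) signature \<Rightarrow> 'u set \<Rightarrow> ('f, 'u) clause set \<Rightarrow> ('f, 'u) clause set" where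
  "theory_of G \<Sigma> X S = \<Inter>{T. quantitative_theory G \<Sigma> X T \<and> S \<subseteq> T}"

text \<open>
  For a lifted signature and a set \<open>S\<close> of Horn clauses the intersection is over a nonempty family
  and is indeed the smallest quantitative theory containing \<open>S\<close>.
\<close>

lemma subst_trm_terms:
  assumes "t \<in> terms \<Sigma> X" "\<forall>x\<in>X. \<sigma> x \<in> terms \<Sigma> X"
  shows "subst_trm \<sigma> t \<in> terms \<Sigma> X"
  using assms by (induction) (auto intro!: terms.intros)

lemma subst_eqn_equations:
  assumes "e \<in> equations \<Sigma> X" "\<forall>x\<in>X. \<sigma> x \<in> terms \<Sigma> X"
  shows "subst_eqn \<sigma> e \<in> equations \<Sigma> X"
  using assms by (auto simp: equations_def subst_trm_terms)

lemma Op_Var_terms: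
  assumes "f \<in> symbols \<Sigma>" "xs \<in> tuples (arity \<Sigma> f) X"
  shows "Op f (map Var xs) \<in> terms \<Sigma> X"
  using assms by (auto simp: tuples_def intro!: terms.intros)

lemma base_clauses_horn:
  assumes sig: "lifted_signature G \<Sigma>"
  shows "base_clauses G \<Sigma> X \<subseteq> horn_clauses \<Sigma> X"
proof (rule subrelI)
  fix \<Gamma> \<phi> assume "(\<Gamma>, \<phi>) \<in> base_clauses G \<Sigma> X"
  then show "(\<Gamma>, \<phi>) \<in> horn_clauses \<Sigma> X"
  proof (cases rule: base_clauses.cases)
    case (infimum x y E)
    have "Inf (insert 1 E) \<in> {0..1}"
      using \<open>E \<subseteq> {0..1}\<close> by (auto intro!: cInf_greatest cInf_lower bdd_belowI[where m = 0])
    then show ?thesis using infimum by (auto simp: horn_clauses_def equations_def subset_iff terms.Var)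
  next
    case (L_NE f xs ys V \<Delta>)
    have "gmet G (tuples (arity \<Sigma> f) V) (lift_of \<Sigma> f V \<Delta>)"
      using sig L_NE by (auto simp: lifted_signature_def lifting_def)
    moreover have "xs \<in> tuples (arity \<Sigma> f) V" "ys \<in> tuples (arity \<Sigma> f) V"
      using L_NE by (auto simp: tuples_def)
    ultimately have "lift_of \<Sigma> f V \<Delta> xs ys \<in> {0..1}"
      by (auto simp: gmet_def fuzzy_relation_def)
    moreover have "V \<subseteq> X" using L_NE by (auto simp: tuples_def)
    moreover have "\<forall>w\<in>V. \<forall>z\<in>V. \<Delta> w z \<in> {0..1}"
      using L_NE by (auto simp: gmet_def fuzzy_relation_def)
    ultimately show ?thesis using L_NE Op_Var_terms
      by (auto simp: horn_clauses_def equations_def intro!: terms.Var)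
  qed (auto simp: horn_clauses_def equations_def Op_Var_terms tuples_def subset_iff intro!: terms.Var)
qed

lemma quantitative_theory_horn_clauses:
  assumes "lifted_signature G \<Sigma>"
  shows "quantitative_theory G \<Sigma> X (horn_clauses \<Sigma> X)"
  using base_clauses_horn[OF assms]
  by (auto simp: quantitative_theory_def horn_clauses_def intro!: subst_eqn_equations)

lemma quantitative_theory_theory_of:
  assumes "lifted_signature G \<Sigma>" "S \<subseteq> horn_clauses \<Sigma> X"
  shows "quantitative_theory G \<Sigma> X (theory_of G \<Sigma> X S)"
proof -
  have "theory_of G \<Sigma> X S \<subseteq> horn_clauses \<Sigma> X"
    using quantitative_theory_horn_clauses[OF assms(1)] assms(2) by (auto simp: theory_of_def)
  moreover have "(subst_eqn \<sigma> ` \<Gamma>, subst_eqn \<sigma> \<phi>) \<in> theory_of G \<Sigma> X S"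
    if "\<forall>x\<in>X. \<sigma> x \<in> terms \<Sigma> X" "(\<Gamma>, \<phi>) \<in> theory_of G \<Sigma> X S" for \<sigma> \<Gamma> \<phi>
    unfolding theory_of_def
  proof (rule InterI, clarify)
    fix T assume T: "quantitative_theory G \<Sigma> X T" "S \<subseteq> T"
    then have "(\<Gamma>, \<phi>) \<in> T" using that(2) by (auto simp: theory_of_def)
    moreover have "\<forall>\<sigma> \<Gamma> \<phi>. (\<forall>x\<in>X. \<sigma> x \<in> terms \<Sigma> X) \<longrightarrow> (\<Gamma>, \<phi>) \<in> T \<longrightarrow>
        (subst_eqn \<sigma> ` \<Gamma>, subst_eqn \<sigma> \<phi>) \<in> T"
      using T(1) by (simp add: quantitative_theory_def)
    ultimately show "(subst_eqn \<sigma> ` \<Gamma>, subst_eqn \<sigma> \<phi>) \<in> T" using that(1) by simp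
  qed
  moreover have "(\<Gamma>, \<psi>) \<in> theory_of G \<Sigma> X S"
    if "\<Gamma> \<subseteq> equations \<Sigma> X" "\<forall>\<phi>\<in>\<Gamma>'. (\<Gamma>, \<phi>) \<in> theory_of G \<Sigma> X S"
      "(\<Gamma>', \<psi>) \<in> theory_of G \<Sigma> X S" for \<Gamma> \<Gamma>' \<psi>
    unfolding theory_of_def
  proof (rule InterI, clarify)
    fix T assume T: "quantitative_theory G \<Sigma> X T" "S \<subseteq> T"
    then have "\<forall>\<phi>\<in>\<Gamma>'. (\<Gamma>, \<phi>) \<in> T" "(\<Gamma>', \<psi>) \<in> T"
      using that(2,3) by (auto simp: theory_of_def)
    moreover have "\<forall>\<Gamma> \<Gamma>' \<psi>. \<Gamma> \<subseteq> equations \<Sigma> X \<longrightarrow> (\<forall>\<phi>\<in>\<Gamma>'. (\<Gamma>, \<phi>) \<in> T) \<longrightarrow>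
        (\<Gamma>', \<psi>) \<in> T \<longrightarrow> (\<Gamma>, \<psi>) \<in> T"
      using T(1) by (simp add: quantitative_theory_def)
    ultimately show "(\<Gamma>, \<psi>) \<in> T" using that(1) by metis
  qed
  moreover have "(\<Gamma>, \<phi>) \<in> theory_of G \<Sigma> X S" if "\<Gamma> \<subseteq> equations \<Sigma> X" "\<phi> \<in> \<Gamma>" for \<Gamma> \<phi>
    using that by (auto simp: theory_of_def quantitative_theory_def)
  moreover have "base_clauses G \<Sigma> X \<subseteq> theory_of G \<Sigma> X S"
    unfolding theory_of_def quantitative_theory_def by (rule Inter_greatest) simp
  ultimately show ?thesis
    unfolding quantitative_theory_def by (intro conjI allI impI) assumption+
qed

lemma theory_of_least:
  "S \<subseteq> theory_of G \<Sigma> X S"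
  "quantitative_theory G \<Sigma> X T \<Longrightarrow> S \<subseteq> T \<Longrightarrow> theory_of G \<Sigma> X S \<subseteq> T"
  by (auto simp: theory_of_def)

end

theory Submission imports Defs begin

text \<open>
  The Horn clauses satisfied by a fixed quantitative algebra form a quantitative theory, so they
  include the smallest one containing \<open>S\<close>. The only axiom that involves the liftings is
  \<open>L_NE\<close>: its premises say precisely that the assignment restricts to a nonexpansive map
  \<open>(V, \<Delta>) \<rightarrow> (A, d)\<close>, which functoriality of the lifting transports to tuples.
\<close>

lemma eval_subst_trm: "eval ops \<iota> (subst_trm \<sigma> t) = eval ops (\<lambda>x. eval ops \<iota> (\<sigma> x)) t"
  by (induction t) (auto simp: o_def cong: map_cong)

lemma holds_subst_eqn:
  "holds d ops \<iota> (subst_eqn \<sigma> \<phi>) \<longleftrightarrow> holds d ops (\<lambda>x. eval ops \<iota> (\<sigma> x)) \<phi>"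
  by (cases \<phi>) (simp_all add: eval_subst_trm)

text \<open>Induction on terms goes through because \<open>nonexpansive\<close> includes the
  requirement that \<open>ops f\<close> maps tuples over \<open>A\<close> into
  \<open>A\<close>.\<close>

lemma eval_in_carrier:
  assumes "t \<in> terms \<Sigma> X" "quantitative_algebra G \<Sigma> (A, d, ops)" "\<forall>x\<in>X. \<iota> x \<in> A"
  shows "eval ops \<iota> t \<in> A"
  using assms(1)
proof induction
  case (Op f ts)
  then have "map (eval ops \<iota>) ts \<in> tuples (arity \<Sigma> f) A"
    by (auto simp: tuples_def)
  then show ?case
    using Op.hyps assms(2) by (auto simp: quantitative_algebra_def nonexpansive_def)
qed (use assms(3) in auto)

text \<open>This gives closure under Sub: an assignment \<open>\<iota>\<close> for the substituted
  clause induces the assignment \<open>\<lambda>x. eval ops \<iota> (\<sigma> x)\<close> for the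
  original one, again with values in \<open>A\<close>.\<close>

lemma satisfies_subst:
  assumes alg: "quantitative_algebra G \<Sigma> (A, d, ops)"
    and \<sigma>: "\<forall>x\<in>X. \<sigma> x \<in> terms \<Sigma> X"
    and sat: "satisfies X (A, d, ops) (\<Gamma>, \<phi>)"
  shows "satisfies X (A, d, ops) (subst_eqn \<sigma> ` \<Gamma>, subst_eqn \<sigma> \<phi>)"
proof -
  have "\<forall>x\<in>X. eval ops \<iota> (\<sigma> x) \<in> A" if "\<forall>x\<in>X. \<iota> x \<in> A" for \<iota>
    using eval_in_carrier[OF _ alg that] \<sigma> by blast
  then show ?thesis
    using sat by (auto simp: satisfies_def holds_subst_eqn)
qed

lemma satisfies_base_clauses:
  assumes sig: "lifted_signature G \<Sigma>"
    and alg: "quantitative_algebra G \<Sigma> (A, d, ops)"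
    and clause: "(\<Gamma>, \<phi>) \<in> base_clauses G \<Sigma> X"
  shows "satisfies X (A, d, ops) (\<Gamma>, \<phi>)"
proof -
  have gm: "gmet G A d"
    using alg by (simp add: quantitative_algebra_def)
  then have range: "0 \<le> d a b" "d a b \<le> 1" if "a \<in> A" "b \<in> A" for a b
    using that by (auto simp: gmet_def fuzzy_relation_def)
  have ax: "satisfies_gaxiom A d ax" if "ax \<in> G" for ax
    using gm that by (simp add: gmet_def)
  have "holds d ops \<iota> \<phi>" if \<iota>: "\<forall>x\<in>X. \<iota> x \<in> A" and prems: "\<forall>\<psi>\<in>\<Gamma>. holds d ops \<iota> \<psi>" for \<iota>
    using clause
  proof (cases rule: base_clauses.cases)
    case (eq_cong f xs ys)
    have "map \<iota> xs = map \<iota> ys"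
      using eq_cong prems by (intro nth_equalityI) (auto simp: tuples_def)
    then show ?thesis
      using eq_cong by (simp add: o_def)
  next
    case (infimum x y E)
    \<comment> \<open>The distance is a lower bound of \<open>E\<close> by the premises, and of the
      added \<open>1\<close> because distances lie in \<open>[0,1]\<close>; the \<open>1\<close>
      also keeps the set nonempty.\<close>
    then have "d (\<iota> x) (\<iota> y) \<le> Inf (insert 1 E)"
      using \<iota> prems range by (intro cInf_greatest) auto
    then show ?thesis
      using infimum by simp
  next
    case (symmetry x y \<epsilon>)
    then show ?thesis
      using ax[of Ax_S] \<iota> prems by auto
  next
    case (reflexivity x)
    then show ?thesis
      using ax[of Ax_R] \<iota> by auto
  next
    case (indiscernibles x y)
    \<comment> \<open>The premise yields only \<open>\<le> 0\<close>; nonnegativity of distances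
      supplies the other half.\<close>
    then have "d (\<iota> x) (\<iota> y) = 0"
      using \<iota> prems range by (intro antisym) auto
    then show ?thesis
      using indiscernibles ax[of Ax_I] \<iota> by auto
  next
    case (triangle x y z \<epsilon> \<epsilon>')
    then have "d (\<iota> x) (\<iota> z) \<le> d (\<iota> x) (\<iota> y) + d (\<iota> y) (\<iota> z)"
      using ax[of Ax_T] \<iota> by auto
    \<comment> \<open>The truncation of the index at \<open>1\<close> is covered by the bound
      \<open>1\<close> on all distances.\<close>
    then show ?thesis
      using triangle \<iota> prems range by auto
  next
    case (ultra_triangle x y z \<epsilon> \<epsilon>')
    then have "d (\<iota> x) (\<iota> z) \<le> max (d (\<iota> x) (\<iota> y)) (d (\<iota> y) (\<iota> z))"
      using ax[of Ax_U] \<iota> by auto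
    then show ?thesis
      using ultra_triangle prems by auto
  next
    case (L_NE f xs ys V \<Delta>)
    let ?n = "arity \<Sigma> f" and ?L = "lift_of \<Sigma> f"
    have tuples: "xs \<in> tuples ?n V" "ys \<in> tuples ?n V"
      using L_NE by (auto simp: tuples_def)
    \<comment> \<open>Every element of \<open>V\<close> occurs in \<open>xs\<close> or
      \<open>ys\<close>, so \<open>\<iota>\<close> sends \<open>V\<close> into
      \<open>A\<close>.\<close>
    have "V \<subseteq> X"
      using L_NE(4-6) by (auto simp: tuples_def)
    moreover have "d (\<iota> w) (\<iota> z) \<le> \<Delta> w z" if "w \<in> V" "z \<in> V" for w z
    proof -
      have "QEq (\<Delta> w z) (Var w) (Var z) \<in> \<Gamma>"
        unfolding L_NE(1) using that by blast
      then show ?thesis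
        using prems by fastforce
    qed
    ultimately have "nonexpansive V \<Delta> A d \<iota>"
      using \<iota> by (simp add: nonexpansive_def subset_iff)
    moreover have "lifting G ?n ?L"
      using sig L_NE(3) by (simp add: lifted_signature_def)
    ultimately have "nonexpansive (tuples ?n V) (?L V \<Delta>) (tuples ?n A) (?L A d) (map \<iota>)"
      using gm L_NE(7) unfolding lifting_def by blast
    then have "map \<iota> xs \<in> tuples ?n A" "map \<iota> ys \<in> tuples ?n A"
      and le: "?L A d (map \<iota> xs) (map \<iota> ys) \<le> ?L V \<Delta> xs ys"
      using tuples by (simp_all add: nonexpansive_def)
    moreover have "nonexpansive (tuples ?n A) (?L A d) A d (ops f)"
      using alg L_NE(3) by (simp add: quantitative_algebra_def)
    \<comment> \<open>Composing \<open>map \<iota>\<close> with \<open>ops f\<close> chains two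
      estimates through the lifted distance on tuples over \<open>A\<close>.\<close>
    ultimately have "d (ops f (map \<iota> xs)) (ops f (map \<iota> ys)) \<le> ?L A d (map \<iota> xs) (map \<iota> ys)"
      by (simp add: nonexpansive_def)
    also note le
    finally have "d (ops f (map \<iota> xs)) (ops f (map \<iota> ys)) \<le> ?L V \<Delta> xs ys" .
    then show ?thesis
      using L_NE(2) by (simp add: o_def)
  \<comment> \<open>What remains are the equivalence laws of equality, the bound \<open>1\<close>,
    enlarging an index, and replacing equals inside \<open>d\<close>.\<close>
  qed (use \<iota> prems range in auto)
  then show ?thesis
    by (simp add: satisfies_def)
qed

text \<open>The restriction to \<open>horn_clauses\<close> is made because \<open>satisfies\<close>
  alone does not force a clause to be well-formed over \<open>\<Sigma>\<close> and
  \<open>X\<close>.\<close>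

lemma quantitative_theory_satisfied_clauses:
  assumes sig: "lifted_signature G \<Sigma>"
    and alg: "quantitative_algebra G \<Sigma> (A, d, ops)"
  shows "quantitative_theory G \<Sigma> X {H \<in> horn_clauses \<Sigma> X. satisfies X (A, d, ops) H}"
    (is "quantitative_theory G \<Sigma> X ?T")
  unfolding quantitative_theory_def
proof (intro conjI allI impI)
  show "?T \<subseteq> horn_clauses \<Sigma> X"
    by blast
next
  fix \<sigma> \<Gamma> \<phi> assume "\<forall>x\<in>X. \<sigma> x \<in> terms \<Sigma> X" "(\<Gamma>, \<phi>) \<in> ?T"
  then show "(subst_eqn \<sigma> ` \<Gamma>, subst_eqn \<sigma> \<phi>) \<in> ?T"
    using satisfies_subst[OF alg] by (auto simp: horn_clauses_def intro!: subst_eqn_equations)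
next
  fix \<Gamma> \<Gamma>' \<psi>
  assume "\<Gamma> \<subseteq> equations \<Sigma> X" "\<forall>\<phi>\<in>\<Gamma>'. (\<Gamma>, \<phi>) \<in> ?T" "(\<Gamma>', \<psi>) \<in> ?T"
  \<comment> \<open>Cut is checked one assignment at a time: if \<open>\<Gamma>\<close> holds there,
    so does all of \<open>\<Gamma>'\<close>, and then \<open>\<psi>\<close>.\<close>
  then show "(\<Gamma>, \<psi>) \<in> ?T"
    by (simp add: horn_clauses_def satisfies_def)
next
  fix \<Gamma> \<phi> assume "\<Gamma> \<subseteq> equations \<Sigma> X" "\<phi> \<in> \<Gamma>"
  then show "(\<Gamma>, \<phi>) \<in> ?T"
    by (auto simp: horn_clauses_def satisfies_def)
next
  show "base_clauses G \<Sigma> X \<subseteq> ?T"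
    using base_clauses_horn[OF sig] satisfies_base_clauses[OF sig alg] by auto
qed

theorem theorem3p14:
  fixes G :: "gaxiom set"
    and \<Sigma> :: "('f, 'u) signature"
    and X :: "'u set"
    and S :: "('f, 'u) clause set"
    and A :: "'u set" and d :: "'u \<Rightarrow> 'u \<Rightarrow> real" and ops :: "'f \<Rightarrow> 'u list \<Rightarrow> 'u"
    and H :: "('f, 'u) clause"
  assumes "countable X"
    and "lifted_signature G \<Sigma>"
    and "S \<subseteq> horn_clauses \<Sigma> X"
    and "(A, d, ops) \<in> Alg G \<Sigma> X S"
    and "H \<in> theory_of G \<Sigma> X S"
  shows "satisfies X (A, d, ops) H"
proof -
  have alg: "quantitative_algebra G \<Sigma> (A, d, ops)" and "\<forall>H\<in>S. satisfies X (A, d, ops) H"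
    using assms(4) by (auto simp: Alg_def)
  then have "S \<subseteq> {H \<in> horn_clauses \<Sigma> X. satisfies X (A, d, ops) H}"
    using assms(3) by blast
  from theory_of_least(2)[OF quantitative_theory_satisfied_clauses[OF assms(2) alg] this]
  show ?thesis
    using assms(5) by blast
qed

end
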